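(* Let $k,m\ge 1$ be integers. (i) The spectrum of the integrated Laplacian matrix of $K^M_{k(m)}$ is $0^{(1)}$, $(2mk)^{(k-1)}$, $(2mk-2m)^{(2mk-k)}$. (ii) The spectrum of the integrated Laplacian matrix of $K^D_{k(m)}$ is $(2mk-2m)^{(1)}$, $0^{(1)}$, $(mk)^{(k-1)}$, $(mk-2m)^{(k-1)}$, $(mk-m)^{(2km-2k)}$. Here $\lambda^{(t)}$ denotes an eigenvalue $\lambda$ with multiplicity $t$.
   Context: A mixed graph has a finite vertex set, a multiset of edges (unordered pairs) and a multiset of arcs (ordered pairs). $K^M_{k(m)}$ is the mixed graph whose vertex set is partitioned into $k$ parts of size $m$, in which for every two vertices $u,v$ in different parts there is exactly one edge $\{u,v\}$, exactly one arc $(u,v)$ and exactly one arc $(v,u)$, and there are no other edges or arcs. $K^D_{k(m)}$ is defined the same way but with no edges (only the arcs $(u,v)$ and $(v,u)$ between different parts). For a vertex $v$, $d(v)$ is the number of edges incident with $v$, and $d^+(v)$ (resp. $d^-(v)$) the number of arcs starting (resp. ending) at $v$. For $V_G=\{v_1,\dots,v_n\}$ the integrated adjacency matrix $\mathcal{I}(G)$ is the $2n\times 2n$ matrix indexed by $v'_1,\dots,v'_n,v''_1,\dots,v''_n$ whose $(v'_i,v'_j)$ and $(v''_i,v''_j)$ entries are the number of edges joining $v_i,v_j$ (and $2\times$ number of loops when $i=j$), and whose $(v'_i,v''_j)$ and $(v''_j,v'_i)$ entries are the number of arcs from $v_i$ to $v_j$. The integrated degree matrix $\mathcal{I}^D(G)$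 is diagonal with $(v'_i,v'_i)$ entry $d(v_i)+d^+(v_i)$ and $(v''_i,v''_i)$ entry $d(v_i)+d^-(v_i)$; the integrated Laplacian matrix is $\mathcal{I}^L(G)=\mathcal{I}^D(G)-\mathcal{I}(G)$. *)

theory Defs
  imports
    "HOL-Library.Uprod"
    "HOL-Library.Multiset"
    "HOL-Library.Disjoint_Sets"
    "Jordan_Normal_Form.Char_Poly"
begin

section \<open>Mixed graphs\<close>

text \<open>Loops are allowed: a loop at \<open>v\<close> is the edge \<open>Upair v v\<close>, a directed loop the arc \<open>(v, v)\<close>.\<close>

record 'a mixed_graph =
  verts :: "'a set"
  edges :: "'a uprod multiset"
  arcs :: "('a \<times> 'a) multiset"

definition wf_mixed_graph :: "'a mixed_graph \<Rightarrow> bool" where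
  "wf_mixed_graph G \<longleftrightarrow>
     finite (verts G) \<and>
     (\<forall>e \<in># edges G. set_uprod e \<subseteq> verts G) \<and>
     set_mset (arcs G) \<subseteq> verts G \<times> verts G"

definition deg :: "'a mixed_graph \<Rightarrow> 'a \<Rightarrow> nat" where
  "deg G v = size {# e \<in># edges G. v \<in> set_uprod e #}"

definition out_deg :: "'a mixed_graph \<Rightarrow> 'a \<Rightarrow> nat" where
  "out_deg G v = size {# a \<in># arcs G. fst a = v #}"

definition in_deg :: "'a mixed_graph \<Rightarrow> 'a \<Rightarrow> nat" where
  "in_deg G v = size {# a \<in># arcs G. snd a = v #}"

section \<open>Integrated matrices\<close>

text \<open>
  The matrices depend on an enumeration \<open>vs\<close> of the vertex set, which must satisfy
  \<open>distinct vs\<close> and \<open>set vs = verts G\<close>. With \<open>n = length vs\<close>, the index \<open>i < n\<close> stands for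
  the first copy of the vertex \<open>vs ! i\<close>, and \<open>n + i\<close> for its second copy.
\<close>

definition edge_block :: "'a mixed_graph \<Rightarrow> 'a list \<Rightarrow> real mat" where
  "edge_block G vs = mat (length vs) (length vs) (\<lambda>(i, j).
     if i = j then 2 * real (count (edges G) (Upair (vs ! i) (vs ! i)))
     else real (count (edges G) (Upair (vs ! i) (vs ! j))))"

definition arc_block :: "'a mixed_graph \<Rightarrow> 'a list \<Rightarrow> real mat" where
  "arc_block G vs = mat (length vs) (length vs) (\<lambda>(i, j).
     real (count (arcs G) (vs ! i, vs ! j)))"

definition integrated_adjacency :: "'a mixed_graph \<Rightarrow> 'a list \<Rightarrow> real mat" where
  "integrated_adjacency G vs =
     four_block_mat (edge_block G vs) (arc_block G vs)
       (transpose_mat (arc_block G vs)) (edge_block G vs)"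

definition integrated_degree :: "'a mixed_graph \<Rightarrow> 'a list \<Rightarrow> real mat" where
  "integrated_degree G vs = (let n = length vs in
     four_block_mat
       (mat_diag n (\<lambda>i. real (deg G (vs ! i) + out_deg G (vs ! i)))) (0\<^sub>m n n)
       (0\<^sub>m n n) (mat_diag n (\<lambda>i. real (deg G (vs ! i) + in_deg G (vs ! i)))))"

definition integrated_laplacian :: "'a mixed_graph \<Rightarrow> 'a list \<Rightarrow> real mat" where
  "integrated_laplacian G vs = integrated_degree G vs - integrated_adjacency G vs"

text \<open>
  The eigenvalues with their algebraic multiplicities. Only real roots are counted, which loses
  nothing for the matrices above, since they are symmetric.
\<close>

definition eigenvalue_mset :: "real mat \<Rightarrow> real multiset" where
  "eigenvalue_mset A = proots (char_poly A)"

section \<open>Complete multipartite mixed graphs and digraphs\<close>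

definition partition_into :: "'a set \<Rightarrow> nat \<Rightarrow> nat \<Rightarrow> 'a set set \<Rightarrow> bool" where
  "partition_into V k m P \<longleftrightarrow> partition_on V P \<and> card P = k \<and> (\<forall>X \<in> P. card X = m)"

definition in_different_parts :: "'a set set \<Rightarrow> 'a \<Rightarrow> 'a \<Rightarrow> bool" where
  "in_different_parts P u v \<longleftrightarrow> (\<exists>X \<in> P. \<exists>Y \<in> P. X \<noteq> Y \<and> u \<in> X \<and> v \<in> Y)"

text \<open>
  The graphs are described up to isomorphism, on an arbitrary vertex type. The conditions range
  over all \<open>u\<close> and \<open>v\<close>, so they also exclude loops and edges or arcs inside a part.
\<close>

definition is_KM :: "nat \<Rightarrow> nat \<Rightarrow> 'a mixed_graph \<Rightarrow> bool" where
  "is_KM k m G \<longleftrightarrow> wf_mixed_graph G \<and>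
     (\<exists>P. partition_into (verts G) k m P \<and>
       (\<forall>u v. count (edges G) (Upair u v) = (if in_different_parts P u v then 1 else 0)) \<and>
       (\<forall>u v. count (arcs G) (u, v) = (if in_different_parts P u v then 1 else 0)))"

definition is_KD :: "nat \<Rightarrow> nat \<Rightarrow> 'a mixed_graph \<Rightarrow> bool" where
  "is_KD k m G \<longleftrightarrow> wf_mixed_graph G \<and>
     (\<exists>P. partition_into (verts G) k m P \<and>
       edges G = {#} \<and>
       (\<forall>u v. count (arcs G) (u, v) = (if in_different_parts P u v then 1 else 0)))"

lemma KM_KD_exist:
  assumes m: "m \<ge> 1"
  shows "\<exists>G :: (nat \<times> nat) mixed_graph. is_KM k m G"
    and "\<exists>G :: (nat \<times> nat) mixed_graph. is_KD k m G"
proof -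
  define part :: "nat \<Rightarrow> (nat \<times> nat) set" where "part i = {i} \<times> {..<m}" for i
  define V :: "(nat \<times> nat) set" where "V = {..<k} \<times> {..<m}"
  define P where "P = part ` {..<k}"
  define A where "A = {(u, v). u \<in> V \<and> v \<in> V \<and> fst u \<noteq> fst v}"
  define E where "E = case_prod Upair ` A"
  have mem_part: "u \<in> part i \<longleftrightarrow> fst u = i \<and> snd u < m" for u i
    by (auto simp: part_def mem_Times_iff)
  have mem_V: "u \<in> V \<longleftrightarrow> fst u < k \<and> snd u < m" for u
    by (simp add: V_def mem_Times_iff)
  have mem_A: "(u, v) \<in> A \<longleftrightarrow> u \<in> V \<and> v \<in> V \<and> fst u \<noteq> fst v" for u v
    by (simp add: A_def)
  have part_0: "(i, 0) \<in> part i" for i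
    using m by (simp add: part_def)
  have part_eq: "part i = part j \<longleftrightarrow> i = j" for i j
    using part_0[of i] mem_part[of "(i, 0)" j] by (metis fst_conv)
  have "inj_on part {..<k}"
    by (simp add: inj_on_def part_eq)
  then have cardP: "card P = k"
    by (simp add: P_def card_image)
  have "partition_on V P"
  proof (rule partition_onI)
    show "\<Union>P = V"
      by (simp add: P_def set_eq_iff mem_part mem_V)
    show "disjnt X Y" if XY: "X \<in> P" "Y \<in> P" "X \<noteq> Y" for X Y
    proof -
      obtain i j where "X = part i" "Y = part j"
        using XY(1,2) unfolding P_def by blast
      then show ?thesis
        using XY(3) by (simp add: disjnt_iff mem_part part_eq)
    qed
    show "{} \<notin> P"
      using part_0 unfolding P_def by blast
  qed
  moreover have "\<forall>X\<in>P. card X = m"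
    by (simp add: P_def part_def card_cartesian_product)
  ultimately have P: "partition_into V k m P"
    using cardP by (simp add: partition_into_def)
  have "in_different_parts P u v \<longleftrightarrow>
      (\<exists>i<k. \<exists>j<k. i \<noteq> j \<and> u \<in> part i \<and> v \<in> part j)" for u v
    unfolding in_different_parts_def P_def by (simp add: part_eq lessThan_def)
  then have diff: "in_different_parts P u v \<longleftrightarrow> (u, v) \<in> A" for u v
    unfolding mem_A mem_V mem_part by metis
  have finV: "finite V" by (simp add: V_def)
  have AV: "A \<subseteq> V \<times> V" unfolding A_def by blast
  have finA: "finite A" by (rule finite_subset[OF AV]) (simp add: finV)
  have finE: "finite E" using finA by (simp add: E_def)
  have E: "Upair u v \<in> E \<longleftrightarrow> (u, v) \<in> A" for u v
  proof
    assume "Upair u v \<in> E"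
    then obtain x y where "(x, y) \<in> A" "Upair u v = Upair x y"
      unfolding E_def by (metis (no_types, lifting) case_prod_conv imageE surj_pair)
    then show "(u, v) \<in> A"
      unfolding mem_A Upair_inject by metis
  next
    assume "(u, v) \<in> A"
    then show "Upair u v \<in> E"
      unfolding E_def by (metis case_prod_conv imageI)
  qed
  have EV: "\<forall>e\<in>E. set_uprod e \<subseteq> V"
  proof
    fix e
    assume "e \<in> E"
    then obtain x y where "(x, y) \<in> A" "e = Upair x y"
      unfolding E_def by (metis (no_types, lifting) case_prod_conv imageE surj_pair)
    then show "set_uprod e \<subseteq> V"
      by (simp add: mem_A)
  qed
  have arcs: "count (mset_set A) (u, v) = (if in_different_parts P u v then 1 else 0)" for u v
    by (simp add: diff count_mset_set' finA)
  have edges: "count (mset_set E) (Upair u v) = (if in_different_parts P u v then 1 else 0)" for u v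
    by (simp add: diff E count_mset_set' finE)
  have "wf_mixed_graph \<lparr>verts = V, edges = mset_set E, arcs = mset_set A\<rparr>"
    using finV finA finE AV EV by (simp add: wf_mixed_graph_def)
  then have "is_KM k m \<lparr>verts = V, edges = mset_set E, arcs = mset_set A\<rparr>"
    unfolding is_KM_def mixed_graph.select_convs using P arcs edges by blast
  then show "\<exists>G :: (nat \<times> nat) mixed_graph. is_KM k m G" ..
  have "wf_mixed_graph \<lparr>verts = V, edges = {#}, arcs = mset_set A\<rparr>"
    using finV finA AV by (simp add: wf_mixed_graph_def)
  then have "is_KD k m \<lparr>verts = V, edges = {#}, arcs = mset_set A\<rparr>"
    unfolding is_KD_def mixed_graph.select_convs using P arcs by blast
  then show "\<exists>G :: (nat \<times> nat) mixed_graph. is_KD k m G" ..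
qed

end

theory Submission
  imports Defs
begin

text \<open>
  Both graphs are regular, and every block of the Laplacian is a linear combination of the identity
  and the adjacency matrix \<open>A\<close> of the complete \<open>k\<close>-partite graph. A matrix with blocks
  \<open>X, Y, Y, X\<close> has the spectra of \<open>X + Y\<close> and \<open>X - Y\<close> together, which reduces everything to \<open>A\<close>.
  As \<open>A\<close> factors through the \<open>k\<close> parts, its nonzero eigenvalues are those of \<open>m\<close> times the
  adjacency matrix of the complete graph on \<open>k\<close> vertices.
\<close>

section \<open>Spectra\<close>

text \<open>Equality with a product of linear factors also records that the characteristic
  polynomial splits, which a multiset of roots does not. Products of characteristic polynomials then
  become sums of multisets.\<close>

definition has_spectrum :: "'a::field mat \<Rightarrow> 'a multiset \<Rightarrow> bool" where
  "has_spectrum A M \<longleftrightarrow> char_poly A = (\<Prod>a\<in>#M. [:- a, 1:])"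

lemma eigenvalue_mset_eqI:
  assumes "has_spectrum A M"
  shows "eigenvalue_mset A = M"
proof -
  have "proots (\<Prod>a\<in>#M. [:- a, 1:]) = M"
  proof (induction M)
    case (add a M)
    have "(\<Prod>a\<in>#M. [:- a, 1:]) \<noteq> 0"
      by (auto simp: prod_mset_zero_iff)
    then have "proots ([:- a, 1:] * (\<Prod>a\<in>#M. [:- a, 1:])) = {#a#} + M"
      by (subst proots_mult) (simp_all add: add)
    then show ?case by simp
  qed simp
  then show ?thesis
    using assms by (simp add: eigenvalue_mset_def has_spectrum_def)
qed

text \<open>Compare degrees. This identifies the exponent \<open>n\<close> produced by a determinant
  with the number of listed eigenvalues.\<close>

lemma has_spectrum_size:
  assumes "has_spectrum A M" and "A \<in> carrier_mat n n"
  shows "size M = n"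
proof -
  have "degree (\<Prod>a\<in>#M. [:- a, 1:]) = size M" for M :: "'a multiset"
  proof (induction M)
    case (add a M)
    have "(\<Prod>a\<in>#M. [:- a, 1:]) \<noteq> 0"
      by (auto simp: prod_mset_zero_iff)
    then have "degree ([:- a, 1:] * (\<Prod>a\<in>#M. [:- a, 1:])) = Suc (size M)"
      by (subst degree_mult_eq) (simp_all add: add)
    then show ?case by simp
  qed simp
  then show ?thesis
    using assms degree_monic_char_poly[of A n] by (simp add: has_spectrum_def)
qed

section \<open>Affine images of a matrix\<close>

lemma poly_char_poly:
  fixes A :: "'a::field mat"
  assumes "A \<in> carrier_mat n n"
  shows "poly (char_poly A) x = det (x \<cdot>\<^sub>m 1\<^sub>m n - A)"
proof -
  have "- char_matrix A x = x \<cdot>\<^sub>m 1\<^sub>m n - A"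
    using assms by (intro eq_matI) (auto simp: char_matrix_def)
  then show ?thesis
    using char_poly_matrix[OF assms] by simp
qed

lemma poly_prod_mset_linear:
  fixes x :: "'a::field"
  shows "poly (\<Prod>a\<in>#M. [:- a, 1:]) x = (\<Prod>a\<in>#M. x - a)"
  by (induction M) (auto simp: algebra_simps)

lemma prod_mset_scaled_diff:
  fixes x :: "'a::field"
  shows "(\<Prod>a\<in>#M. d * (x - a)) = d ^ size M * (\<Prod>a\<in>#M. x - a)"
  by (simp add: prod_mset.distrib)

text \<open>For \<open>d \<noteq> 0\<close>, pull \<open>d\<close> out of the determinant of
  \<open>x - c - d A = d ((x - c) / d - A)\<close> and compare the values of both polynomials at
  every \<open>x\<close>.\<close>

lemma has_spectrum_affine:
  fixes A :: "'a::field_char_0 mat"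
  assumes A: "A \<in> carrier_mat n n" and M: "has_spectrum A M"
  shows "has_spectrum (c \<cdot>\<^sub>m 1\<^sub>m n + d \<cdot>\<^sub>m A) {#c + d * a. a \<in># M#}"
proof -
  let ?B = "c \<cdot>\<^sub>m 1\<^sub>m n + d \<cdot>\<^sub>m A"
  have B: "?B \<in> carrier_mat n n" using A by simp
  have "poly (char_poly ?B) x = poly (\<Prod>a\<in>#{#c + d * a. a \<in># M#}. [:- a, 1:]) x" for x
  proof (cases "d = 0")
    case True
    have "x \<cdot>\<^sub>m 1\<^sub>m n - ?B = (x - c) \<cdot>\<^sub>m 1\<^sub>m n"
      using A True by (intro eq_matI) auto
    then have "poly (char_poly ?B) x = (x - c) ^ n"
      by (simp add: poly_char_poly[OF B])
    then show ?thesis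
      by (simp add: poly_prod_mset_linear True multiset.map_comp comp_def
          has_spectrum_size[OF M A] image_mset_const_eq)
  next
    case False
    have "x \<cdot>\<^sub>m 1\<^sub>m n - ?B = d \<cdot>\<^sub>m (((x - c) / d) \<cdot>\<^sub>m 1\<^sub>m n - A)"
      using A False by (intro eq_matI) (auto simp: field_simps)
    then have "poly (char_poly ?B) x = d ^ n * poly (char_poly A) ((x - c) / d)"
      using A by (simp add: poly_char_poly[OF B] poly_char_poly[OF A])
    \<comment> \<open>As \<open>size M = n\<close>, the power \<open>d ^ n\<close> supplies one
      factor \<open>d\<close> per eigenvalue.\<close>
    also have "\<dots> = (\<Prod>a\<in>#M. d * ((x - c) / d - a))"
      using M unfolding prod_mset_scaled_diff
      by (simp add: has_spectrum_def poly_prod_mset_linear has_spectrum_size[OF M A])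
    also have "\<dots> = (\<Prod>a\<in>#M. x - (c + d * a))"
      using False by (intro arg_cong[where f = prod_mset] image_mset_cong) (simp add: field_simps)
    finally show ?thesis
      by (subst poly_prod_mset_linear) (simp add: multiset.map_comp comp_def)
  qed
  \<comment> \<open>A field of characteristic zero is infinite, so a polynomial is determined by its
    values.\<close>
  then show ?thesis
    by (simp add: has_spectrum_def poly_eq_poly_eq_iff[symmetric] fun_eq_iff)
qed

section \<open>Block matrices and products in either order\<close>

lemma char_poly_block_lower_triangular:
  fixes A :: "'a::idom mat"
  assumes A: "A \<in> carrier_mat n n" and C: "C \<in> carrier_mat m n" and D: "D \<in> carrier_mat m m"
  shows "char_poly (four_block_mat A (0\<^sub>m n m) C D) = char_poly A * char_poly D"
proof -
  have "char_poly_matrix (four_block_mat A (0\<^sub>m n m) C D) =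
      four_block_mat (char_poly_matrix A) (0\<^sub>m n m) (map_mat (\<lambda>a. [:- a:]) C) (char_poly_matrix D)"
    using assms by (intro eq_matI) (auto simp: char_poly_matrix_def one_poly_def)
  then show ?thesis
    unfolding char_poly_def using assms
    by (simp add: det_four_block_mat_upper_right_zero[where n = n and m = m])
qed

text \<open>
  The two sides are the characteristic polynomials of block lower triangular matrices with lower
  left block \<open>Q\<close>, which are conjugate under the unipotent matrix with upper right block \<open>P\<close>.
\<close>

lemma char_poly_mult_commute:
  fixes P :: "'a::idom mat"
  assumes P: "P \<in> carrier_mat n k" and Q: "Q \<in> carrier_mat k n"
  shows "char_poly (P * Q) * [:0, 1:] ^ k = [:0, 1:] ^ n * char_poly (Q * P)"
proof -
  let ?X = "four_block_mat (P * Q) (0\<^sub>m n k) Q (0\<^sub>m k k)"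
  let ?Y = "four_block_mat (0\<^sub>m n n) (0\<^sub>m n k) Q (Q * P)"
  let ?S = "four_block_mat (1\<^sub>m n) P (0\<^sub>m k n) (1\<^sub>m k)"
  let ?T = "four_block_mat (1\<^sub>m n) (- P) (0\<^sub>m k n) (1\<^sub>m k)"
  have ST: "?S * ?T = 1\<^sub>m (n + k)" and TS: "?T * ?S = 1\<^sub>m (n + k)"
    using P by (subst mult_four_block_mat[of _ n n _ k _ k _ _ n _ k]; auto intro!: eq_matI)+
  have SY: "?S * ?Y = four_block_mat (P * Q) (P * (Q * P)) Q (Q * P)"
    using P Q by (simp add: mult_four_block_mat[of _ n n _ k _ k _ _ n _ k])
  \<comment> \<open>Right multiplication by \<open>?T\<close> subtracts the first block column times
    \<open>P\<close> from the second block column, which becomes zero.\<close>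
  have "?S * ?Y * ?T = ?X"
    using P Q unfolding SY
    by (subst mult_four_block_mat[of _ n n _ k _ k _ _ n _ k]) auto
  then have "similar_mat ?X ?Y"
    using P Q ST TS by (intro similar_matI[of _ _ ?S ?T "n + k"]) auto
  from char_poly_similar[OF this]
  have "char_poly (P * Q) * char_poly (0\<^sub>m k k) = char_poly (0\<^sub>m n n) * char_poly (Q * P)"
    using P Q by (simp add: char_poly_block_lower_triangular)
  moreover have "char_poly (0\<^sub>m r r :: 'a mat) = [:0, 1:] ^ r" for r
  proof -
    have "diag_mat (0\<^sub>m r r :: 'a mat) = replicate r 0"
      by (auto simp: diag_mat_def intro: nth_equalityI)
    then show ?thesis
      using char_poly_upper_triangular[of "0\<^sub>m r r :: 'a mat" r]
      by (auto simp: prod_list_replicate)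
  qed
  ultimately show ?thesis by simp
qed

text \<open>Cancelling \<open>[:0, 1:] ^ k\<close> in the preceding identity leaves
  \<open>n - k\<close> surplus factors, which are the additional zero eigenvalues of the larger
  product.\<close>

lemma has_spectrum_mult_commute:
  assumes P: "P \<in> carrier_mat n k" and Q: "Q \<in> carrier_mat k n" and "k \<le> n"
    and M: "has_spectrum (Q * P) M"
  shows "has_spectrum (P * Q) (M + replicate_mset (n - k) 0)"
proof -
  have "[:0, 1:] ^ n = [:0, 1:] ^ (n - k) * [:0, 1 :: 'a:] ^ k"
    using \<open>k \<le> n\<close> by (simp flip: power_add)
  then have "char_poly (P * Q) = char_poly (Q * P) * [:0, 1:] ^ (n - k)"
    using char_poly_mult_commute[OF P Q] by (simp add: ac_simps)
  then show ?thesis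
    using M by (simp add: has_spectrum_def)
qed

text \<open>Vectors \<open>(v, v)\<close> and \<open>(v, -v)\<close> are acted on through
  \<open>X + Y\<close> and \<open>X - Y\<close>. Conjugation by a unipotent block matrix makes the
  matrix block triangular with these two diagonal blocks; it needs no division by 2 and so works
  over every field.\<close>

lemma has_spectrum_symmetric_block:
  fixes X Y :: "'a::field mat"
  assumes X: "X \<in> carrier_mat n n" and Y: "Y \<in> carrier_mat n n"
    and M: "has_spectrum (X + Y) M" and N: "has_spectrum (X - Y) N"
  shows "has_spectrum (four_block_mat X Y Y X) (M + N)"
proof -
  let ?B = "four_block_mat (X - Y) (0\<^sub>m n n) Y (X + Y)"
  let ?S = "four_block_mat (1\<^sub>m n) (1\<^sub>m n :: 'a mat) (0\<^sub>m n n) (1\<^sub>m n)"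
  let ?T = "four_block_mat (1\<^sub>m n) (- 1\<^sub>m n :: 'a mat) (0\<^sub>m n n) (1\<^sub>m n)"
  have ST: "?S * ?T = 1\<^sub>m (n + n)" and TS: "?T * ?S = 1\<^sub>m (n + n)"
    by (subst mult_four_block_mat[of _ n n _ n _ n _ _ n _ n]; auto intro!: eq_matI)+
  have XY: "X - Y + Y = X"
    using X Y by (intro eq_matI) auto
  have YX: "- X + (X + Y) = Y" "- Y + (X + Y) = X"
    using X Y by (auto intro!: eq_matI)
  have SB: "?S * ?B = four_block_mat X (X + Y) Y (X + Y)"
    using X Y by (subst mult_four_block_mat[of _ n n _ n _ n _ _ n _ n]) (auto simp: XY)
  have "?S * ?B * ?T = four_block_mat X Y Y X"
    using X Y unfolding SB
    by (subst mult_four_block_mat[of _ n n _ n _ n _ _ n _ n]) (auto simp: YX)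
  then have "similar_mat (four_block_mat X Y Y X) ?B"
    using X Y ST TS by (intro similar_matI[of _ _ ?S ?T "n + n"]) auto
  moreover have "char_poly ?B = char_poly (X - Y) * char_poly (X + Y)"
    using X Y by (intro char_poly_block_lower_triangular) auto
  ultimately show ?thesis
    using M N char_poly_similar[of "four_block_mat X Y Y X" ?B]
    by (simp add: has_spectrum_def mult.commute)
qed

text \<open>The matrix is a column of ones times a row of ones; the product in the other order is
  the 1 by 1 matrix with entry \<open>k\<close>.\<close>

lemma has_spectrum_all_ones:
  assumes "k \<ge> 1"
  shows "has_spectrum (mat k k (\<lambda>_. 1 :: 'a::field)) (add_mset (of_nat k) (replicate_mset (k - 1) 0))"
proof -
  let ?P = "mat k 1 (\<lambda>_. 1 :: 'a)" and ?Q = "mat 1 k (\<lambda>_. 1 :: 'a)"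
  have "upper_triangular (?Q * ?P)" "diag_mat (?Q * ?P) = [of_nat k]"
    by (auto simp: diag_mat_def scalar_prod_def)
  then have "has_spectrum (?Q * ?P) {#of_nat k#}"
    using char_poly_upper_triangular[of "?Q * ?P" 1] unfolding has_spectrum_def by force
  moreover have "?P * ?Q = mat k k (\<lambda>_. 1)"
    by (intro eq_matI) (auto simp: scalar_prod_def)
  ultimately show ?thesis
    using has_spectrum_mult_commute[of ?P k 1 ?Q "{#of_nat k#}"] assms by simp
qed

section \<open>Complete multipartite graphs\<close>

lemma in_different_parts_commute: "in_different_parts P u v \<longleftrightarrow> in_different_parts P v u"
  unfolding in_different_parts_def by metis

text \<open>The parts are disjoint, so \<open>X\<close> is the only one that contains
  \<open>u\<close>.\<close>

lemma in_different_parts_iff: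
  assumes "partition_on V P" and "X \<in> P" and "u \<in> X"
  shows "in_different_parts P u v \<longleftrightarrow> v \<in> V - X"
proof
  assume "in_different_parts P u v"
  then obtain Y Z where YZ: "Y \<in> P" "Z \<in> P" "Y \<noteq> Z" "u \<in> Y" "v \<in> Z"
    unfolding in_different_parts_def by blast
  have "Y = X"
    using disjointD[OF partition_onD2[OF assms(1)] YZ(1) assms(2)] YZ(4) assms(3) by blast
  then have "v \<notin> X"
    using disjointD[OF partition_onD2[OF assms(1)] YZ(2) assms(2)] YZ(3,5) by blast
  moreover have "v \<in> V"
    using YZ(2,5) unfolding partition_onD1[OF assms(1)] by blast
  ultimately show "v \<in> V - X" by blast
next
  assume "v \<in> V - X"
  then have "v \<in> \<Union>P" "v \<notin> X"
    unfolding partition_onD1[OF assms(1)] by blast+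
  then obtain Y where "Y \<in> P" "v \<in> Y" by blast
  then show "in_different_parts P u v"
    using assms(2,3) \<open>v \<notin> X\<close> unfolding in_different_parts_def by metis
qed

section \<open>Counting vertices and degrees\<close>

lemma card_partition_into:
  assumes "partition_into V k m P" and "finite V"
  shows "card V = m * k"
proof -
  have P: "partition_on V P" "card P = k" "\<forall>X\<in>P. card X = m"
    using assms by (auto simp: partition_into_def)
  have "m * card P = card (\<Union>P)"
  proof (rule card_partition)
    show "finite P" using finite_elements[OF assms(2) P(1)] .
    show "finite (\<Union>P)" using assms(2) partition_onD1[OF P(1)] by simp
    show "A \<inter> B = {}" if "A \<in> P" "B \<in> P" "A \<noteq> B" for A B
      using that partition_onD2[OF P(1)] by (auto simp: disjoint_def)
  qed (use P in auto)
  then show ?thesis using P partition_onD1[OF P(1)] by simp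
qed

lemma card_in_different_parts:
  assumes P: "partition_into V k m P" and V: "finite V" and u: "u \<in> V"
  shows "card {v. in_different_parts P u v} = m * k - m" and "finite {v. in_different_parts P u v}"
proof -
  have part: "partition_on V P" using P by (simp add: partition_into_def)
  obtain X where X: "X \<in> P" "u \<in> X"
    using u partition_onD1[OF part] by blast
  have eq: "{v. in_different_parts P u v} = V - X"
    using in_different_parts_iff[OF part X] by blast
  have "X \<subseteq> V" using X partition_onD1[OF part] by blast
  then show "card {v. in_different_parts P u v} = m * k - m"
    using P X V card_partition_into[OF P V]
    by (simp add: eq card_Diff_subset finite_subset partition_into_def)
  show "finite {v. in_different_parts P u v}"
    using V by (simp add: eq)
qed

text \<open>All multiplicities are at most one, so the arcs leaving \<open>u\<close> correspond
  bijectively to their heads.\<close>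

lemma out_deg_eq_card:
  assumes "\<And>u v. count (arcs G) (u, v) = (if R u v then 1 else 0)" and "finite {v. R u v}"
  shows "out_deg G u = card {v. R u v}"
proof -
  have "{#a \<in># arcs G. fst a = u#} = mset_set (Pair u ` {v. R u v})"
    using assms by (intro multiset_eqI) (auto simp: count_mset_set')
  then show ?thesis
    by (simp add: out_deg_def card_image inj_on_def)
qed

lemma in_deg_eq_card:
  assumes "\<And>u v. count (arcs G) (u, v) = (if R u v then 1 else 0)" and "finite {u. R u v}"
  shows "in_deg G v = card {u. R u v}"
proof -
  have "{#a \<in># arcs G. snd a = v#} = mset_set ((\<lambda>u. (u, v)) ` {u. R u v})"
    using assms by (intro multiset_eqI) (auto simp: count_mset_set')
  then show ?thesis
    by (simp add: in_deg_def card_image inj_on_def)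
qed

lemma deg_eq_card:
  fixes G :: "'a mixed_graph"
  assumes R: "\<And>u v. count (edges G) (Upair u v) = (if R u v then 1 else 0)"
    and fin: "finite {v. R u v}"
  shows "deg G u = card {v. R u v}"
proof -
  \<comment> \<open>Unordered pairs force \<open>R\<close> to be symmetric, so every edge at
    \<open>u\<close> can be written with \<open>u\<close> as its first end.\<close>
  have sym: "R v w \<longleftrightarrow> R w v" for v w
  proof -
    have "Upair v w = Upair w v" by simp
    then show ?thesis
      using R[of v w] R[of w v] by (metis zero_neq_one)
  qed
  have "{#e \<in># edges G. u \<in> set_uprod e#} = mset_set (Upair u ` {v. R u v})"
  proof (rule multiset_eqI)
    fix e :: "'a uprod"
    obtain v w where e: "e = Upair v w" by (cases e)
    show "count {#e \<in># edges G. u \<in> set_uprod e#} e = count (mset_set (Upair u ` {v. R u v})) e"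
      using fin sym[of u] by (auto simp: e R count_mset_set')
  qed
  then show ?thesis
    by (simp add: deg_def card_image inj_on_def)
qed

section \<open>The adjacency matrix of the complete multipartite graph\<close>

definition parts_adjacency :: "'a set set \<Rightarrow> 'a list \<Rightarrow> real mat" where
  "parts_adjacency P vs = mat (length vs) (length vs)
     (\<lambda>(i, j). of_bool (in_different_parts P (vs ! i) (vs ! j)))"

lemma parts_adjacency_carrier [simp]:
  "parts_adjacency P vs \<in> carrier_mat (length vs) (length vs)"
  by (simp add: parts_adjacency_def)

lemma transpose_parts_adjacency [simp]:
  "transpose_mat (parts_adjacency P vs) = parts_adjacency P vs"
  by (intro eq_matI) (auto simp: parts_adjacency_def in_different_parts_commute)

lemma arc_block_eq_parts_adjacency:
  assumes "\<And>u v. count (arcs G) (u, v) = (if in_different_parts P u v then 1 else 0)"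
  shows "arc_block G vs = parts_adjacency P vs"
  by (auto simp: arc_block_def parts_adjacency_def assms intro!: eq_matI)

lemma edge_block_eq_parts_adjacency:
  assumes "partition_on V P"
    and "\<And>u v. count (edges G) (Upair u v) = (if in_different_parts P u v then 1 else 0)"
  shows "edge_block G vs = parts_adjacency P vs"
proof -
  \<comment> \<open>There are no loops, so the doubled diagonal entries of \<open>edge_block\<close>
    vanish.\<close>
  have "\<not> in_different_parts P u u" for u
    using partition_onD2[OF assms(1)] unfolding in_different_parts_def disjoint_def by blast
  then show ?thesis
    by (auto simp: edge_block_def parts_adjacency_def assms(2) intro!: eq_matI)
qed

text \<open>
  The adjacency matrix is \<open>U * W\<close>, where \<open>U\<close> is the incidence matrix of vertices and parts and
  \<open>W\<close> is the transposed incidence matrix of vertices and complements of parts. The product in the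
  other order is the \<open>k \<times> k\<close> matrix with \<open>0\<close> on the diagonal and \<open>m\<close> elsewhere.
\<close>

lemma has_spectrum_parts_adjacency:
  assumes P: "partition_into V k m P" and vs: "distinct vs" "set vs = V"
    and k: "k \<ge> 1" and m: "m \<ge> 1"
  shows "has_spectrum (parts_adjacency P vs)
    (add_mset (real m * real k - real m)
      (replicate_mset (k - 1) (- real m) + replicate_mset (m * k - k) 0))"
proof -
  have part: "partition_on V P" "card P = k" "\<And>X. X \<in> P \<Longrightarrow> card X = m"
    using P by (auto simp: partition_into_def)
  have finV: "finite V" using vs by auto
  define n where "n = length vs"
  have n: "n = m * k"
    using card_partition_into[OF P finV] distinct_card[OF vs(1)] vs(2) by (simp add: n_def)
  \<comment> \<open>A listing of the parts provides the column indices of \<open>U\<close>.\<close>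
  obtain ps where ps: "set ps = P" "distinct ps"
    using finite_distinct_list[OF finite_elements[OF finV part(1)]] by blast
  have lps: "length ps = k"
    using distinct_card[OF ps(2)] ps(1) part(2) by simp
  have sum_ps: "(\<Sum>p = 0..<k. f (ps ! p)) = (\<Sum>X\<in>P. f X)" for f :: "'a set \<Rightarrow> real"
    using sum.reindex_bij_betw[OF bij_betw_nth[OF ps(2), of "{0..<k}" P]] ps lps
    by (simp add: atLeast0LessThan)
  have sum_vs: "(\<Sum>i = 0..<n. f (vs ! i)) = (\<Sum>v\<in>V. f v)" for f :: "'a \<Rightarrow> real"
    using sum.reindex_bij_betw[OF bij_betw_nth[OF vs(1), of "{0..<n}" V]] vs
    by (simp add: atLeast0LessThan n_def)
  define U where "U = mat n k (\<lambda>(i, p). of_bool (vs ! i \<in> ps ! p) :: real)"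
  define W where "W = mat k n (\<lambda>(p, i). of_bool (vs ! i \<notin> ps ! p) :: real)"
  have U: "U \<in> carrier_mat n k" and W: "W \<in> carrier_mat k n"
    by (simp_all add: U_def W_def)
  have "U * W = parts_adjacency P vs"
  proof (rule eq_matI)
    fix i j
    assume "i < dim_row (parts_adjacency P vs)" "j < dim_col (parts_adjacency P vs)"
    then have ij: "i < n" "j < n" by (simp_all add: parts_adjacency_def n_def)
    then have V: "vs ! i \<in> V" "vs ! j \<in> V" using vs(2) n_def by auto
    then obtain X where X: "X \<in> P" "vs ! i \<in> X"
      using partition_onD1[OF part(1)] by blast
    \<comment> \<open>Hence only the summand for \<open>X\<close> survives in the entry of
      \<open>U * W\<close>.\<close>
    have uniq: "Y \<in> P \<Longrightarrow> vs ! i \<in> Y \<longleftrightarrow> Y = X" for Y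
      using X partition_onD2[OF part(1)] unfolding disjoint_def by blast
    have "(U * W) $$ (i, j) = (\<Sum>Y\<in>P. of_bool (vs ! i \<in> Y) * of_bool (vs ! j \<notin> Y))"
      using ij by (simp add: U_def W_def scalar_prod_def sum_ps[symmetric])
    also have "\<dots> = (\<Sum>Y\<in>P. if Y = X then of_bool (vs ! j \<notin> X) else 0)"
      by (rule sum.cong) (auto simp: uniq)
    also have "\<dots> = of_bool (vs ! j \<notin> X)"
      using X finite_elements[OF finV part(1)] by simp
    also have "\<dots> = parts_adjacency P vs $$ (i, j)"
      using ij V by (simp add: parts_adjacency_def n_def in_different_parts_iff[OF part(1) X])
    finally show "(U * W) $$ (i, j) = parts_adjacency P vs $$ (i, j)" .
  qed (simp_all add: U_def W_def parts_adjacency_def n_def)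
  moreover have "W * U = (- real m) \<cdot>\<^sub>m 1\<^sub>m k + real m \<cdot>\<^sub>m mat k k (\<lambda>_. 1)"
  proof (rule eq_matI)
    fix p q
    assume "p < dim_row ((- real m) \<cdot>\<^sub>m 1\<^sub>m k + real m \<cdot>\<^sub>m mat k k (\<lambda>_. 1))"
      "q < dim_col ((- real m) \<cdot>\<^sub>m 1\<^sub>m k + real m \<cdot>\<^sub>m mat k k (\<lambda>_. 1))"
    then have pq: "p < k" "q < k" by simp_all
    then have PQ: "ps ! p \<in> P" "ps ! q \<in> P" "ps ! p = ps ! q \<longleftrightarrow> p = q"
      using ps lps by (auto simp: nth_eq_iff_index_eq)
    \<comment> \<open>The entry counts the vertices of part \<open>q\<close> outside part
      \<open>p\<close>: all of part \<open>q\<close>, unless \<open>p = q\<close>.\<close>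
    have "(W * U) $$ (p, q) = (\<Sum>v\<in>V. of_bool (v \<notin> ps ! p) * of_bool (v \<in> ps ! q))"
      using pq by (simp add: U_def W_def scalar_prod_def sum_vs[symmetric])
    also have "\<dots> = (\<Sum>v\<in>V. of_bool (v \<in> ps ! q - ps ! p))"
      by (rule sum.cong) auto
    also have "\<dots> = real (card (V \<inter> (ps ! q - ps ! p)))"
      using finV by (simp add: sum_of_bool_eq Int_def)
    also have "V \<inter> (ps ! q - ps ! p) = (if p = q then {} else ps ! q)"
      using PQ partition_onD1[OF part(1)] partition_onD2[OF part(1)]
      by (auto simp: disjoint_def)
    finally show "(W * U) $$ (p, q) =
        ((- real m) \<cdot>\<^sub>m 1\<^sub>m k + real m \<cdot>\<^sub>m mat k k (\<lambda>_. 1)) $$ (p, q)"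
      using pq PQ part(3) by simp
  qed (simp_all add: U_def W_def)
  \<comment> \<open>The eigenvalues \<open>k\<close> and \<open>0\<close> of the all-ones matrix
    become \<open>m k - m\<close> and \<open>- m\<close>.\<close>
  moreover have "has_spectrum ((- real m) \<cdot>\<^sub>m 1\<^sub>m k + real m \<cdot>\<^sub>m mat k k (\<lambda>_. 1))
      (add_mset (real m * real k - real m) (replicate_mset (k - 1) (- real m)))"
    using has_spectrum_affine[OF _ has_spectrum_all_ones[OF k], of k "- real m" "real m"] by simp
  moreover have "k \<le> n" using m n by simp
  ultimately show ?thesis
    using has_spectrum_mult_commute[OF U W] n by (metis union_mset_add_mset_left)
qed

section \<open>The integrated Laplacian\<close>

text \<open>Symmetry of the arc block equates the two off-diagonal blocks, and the common degree
  \<open>c\<close> equates the two diagonal ones. This gives the shape required by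
  \<open>has_spectrum_symmetric_block\<close>.\<close>

lemma integrated_laplacian_regular:
  assumes "transpose_mat (arc_block G vs) = arc_block G vs"
    and "\<And>v. v \<in> set vs \<Longrightarrow> real (deg G v + out_deg G v) = c"
    and "\<And>v. v \<in> set vs \<Longrightarrow> real (deg G v + in_deg G v) = c"
  shows "integrated_laplacian G vs =
    four_block_mat (c \<cdot>\<^sub>m 1\<^sub>m (length vs) - edge_block G vs) (- arc_block G vs)
      (- arc_block G vs) (c \<cdot>\<^sub>m 1\<^sub>m (length vs) - edge_block G vs)"
  unfolding integrated_laplacian_def integrated_degree_def integrated_adjacency_def Let_def assms(1)
  using assms(2,3)
  by (intro eq_matI) (auto simp: mat_diag_def edge_block_def arc_block_def simp del: of_nat_add)

lemma replicate_mset_add: "replicate_mset (a + b) x = replicate_mset a x + replicate_mset b x"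
  by (induction a) auto

text \<open>With \<open>c = 2 (m k - m)\<close> the blocks are \<open>X = c - A\<close> and
  \<open>Y = - A\<close>. Thus \<open>X + Y = c - 2 A\<close>, while \<open>X - Y = c\<close> is
  scalar.\<close>

lemma eigenvalue_mset_KM:
  assumes G: "is_KM k m G" and vs: "distinct vs" "set vs = verts G" and k: "k \<ge> 1" and m: "m \<ge> 1"
  shows "eigenvalue_mset (integrated_laplacian G vs) =
      replicate_mset 1 0
    + replicate_mset (k - 1) (2 * real m * real k)
    + replicate_mset (2 * m * k - k) (2 * real m * real k - 2 * real m)"
proof -
  obtain P where P: "partition_into (verts G) k m P"
    and edges: "\<And>u v. count (edges G) (Upair u v) = (if in_different_parts P u v then 1 else 0)"
    and arcs: "\<And>u v. count (arcs G) (u, v) = (if in_different_parts P u v then 1 else 0)"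
    using G by (auto simp: is_KM_def)
  have V: "finite (verts G)" using vs(2) by (metis List.finite_set)
  let ?n = "length vs" and ?A = "parts_adjacency P vs"
  let ?c = "2 * (real m * real k - real m)"
  have part: "partition_on (verts G) P" using P by (simp add: partition_into_def)
  \<comment> \<open>These bounds keep the truncated subtractions of natural numbers exact.\<close>
  have "m \<le> m * k" "k \<le> m * k" using k m by simp_all
  note card = card_in_different_parts[OF P V]
  have "deg G v + out_deg G v = 2 * (m * k - m)" "deg G v + in_deg G v = 2 * (m * k - m)"
    if "v \<in> set vs" for v
    using that vs(2) card[of v]
      deg_eq_card[OF edges, of v] out_deg_eq_card[OF arcs, of v] in_deg_eq_card[OF arcs, of v]
    by (simp_all add: in_different_parts_commute[of P _ v])
  then have L: "integrated_laplacian G vs =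
      four_block_mat (?c \<cdot>\<^sub>m 1\<^sub>m ?n - ?A) (- ?A) (- ?A) (?c \<cdot>\<^sub>m 1\<^sub>m ?n - ?A)"
    using \<open>m \<le> m * k\<close>
    by (subst integrated_laplacian_regular[where c = ?c])
      (simp_all add: arc_block_eq_parts_adjacency[OF arcs]
        edge_block_eq_parts_adjacency[OF part edges] of_nat_diff flip: of_nat_add)
  note affine = has_spectrum_affine[OF parts_adjacency_carrier
      has_spectrum_parts_adjacency[OF P vs k m], of ?c]
  \<comment> \<open>The scalar matrix is written with the summand \<open>0 * A\<close> so that both
    halves are affine images of \<open>A\<close>.\<close>
  have "?c \<cdot>\<^sub>m 1\<^sub>m ?n - ?A + - ?A = ?c \<cdot>\<^sub>m 1\<^sub>m ?n + (- 2) \<cdot>\<^sub>m ?A"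
    "?c \<cdot>\<^sub>m 1\<^sub>m ?n - ?A - - ?A = ?c \<cdot>\<^sub>m 1\<^sub>m ?n + 0 \<cdot>\<^sub>m ?A"
    by (auto intro!: eq_matI simp: parts_adjacency_def)
  then have "eigenvalue_mset (integrated_laplacian G vs) =
     {#?c + (- 2) * a. a \<in># add_mset (real m * real k - real m)
      (replicate_mset (k - 1) (- real m) + replicate_mset (m * k - k) 0)#} +
     {#?c + 0 * a. a \<in># add_mset (real m * real k - real m)
      (replicate_mset (k - 1) (- real m) + replicate_mset (m * k - k) 0)#}"
    unfolding L using affine[of "- 2"] affine[of 0]
    by (intro eigenvalue_mset_eqI has_spectrum_symmetric_block[where n = ?n])
      (simp_all add: minus_carrier_mat)
  moreover have "?c + (- 2) * (real m * real k - real m) = 0"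
    "?c + (- 2) * (- real m) = 2 * real m * real k"
    "?c + (- 2) * 0 = 2 * real m * real k - 2 * real m"
    "?c + 0 * a = 2 * real m * real k - 2 * real m" for a
    by (simp_all add: algebra_simps)
  \<comment> \<open>The scalar half contributes all \<open>m k = Suc (k - 1) + (m k - k)\<close> of
    its eigenvalues, and the kernel of \<open>A\<close> another \<open>m k - k\<close> in the other
    half.\<close>
  moreover have "2 * m * k - k = Suc (k - 1) + (m * k - k) + (m * k - k)"
    using \<open>k \<le> m * k\<close> k by linarith
  ultimately show ?thesis
    by (simp only: image_mset_add_mset image_mset_union image_replicate_mset replicate_mset_add
        replicate_mset_Suc One_nat_def replicate_mset_0) simp
qed

text \<open>Here \<open>X = c\<close> and \<open>Y = - A\<close> with \<open>c = m k - m\<close>, so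
  each eigenvalue \<open>a\<close> of \<open>A\<close> yields the two values \<open>c - a\<close>
  and \<open>c + a\<close>.\<close>

lemma eigenvalue_mset_KD:
  assumes G: "is_KD k m G" and vs: "distinct vs" "set vs = verts G" and k: "k \<ge> 1" and m: "m \<ge> 1"
  shows "eigenvalue_mset (integrated_laplacian G vs) =
      replicate_mset 1 (2 * real m * real k - 2 * real m)
    + replicate_mset 1 0
    + replicate_mset (k - 1) (real m * real k)
    + replicate_mset (k - 1) (real m * real k - 2 * real m)
    + replicate_mset (2 * k * m - 2 * k) (real m * real k - real m)"
proof -
  obtain P where P: "partition_into (verts G) k m P"
    and edges: "edges G = {#}"
    and arcs: "\<And>u v. count (arcs G) (u, v) = (if in_different_parts P u v then 1 else 0)"
    using G by (auto simp: is_KD_def)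
  have V: "finite (verts G)" using vs(2) by (metis List.finite_set)
  let ?n = "length vs" and ?A = "parts_adjacency P vs"
  let ?c = "real m * real k - real m"
  have "m \<le> m * k" "k \<le> m * k" using k m by simp_all
  note card = card_in_different_parts[OF P V]
  have "deg G v + out_deg G v = m * k - m" "deg G v + in_deg G v = m * k - m"
    if "v \<in> set vs" for v
    using that vs(2) card[of v] out_deg_eq_card[OF arcs, of v] in_deg_eq_card[OF arcs, of v]
    by (simp_all add: deg_def edges in_different_parts_commute[of P _ v])
  moreover have "?c \<cdot>\<^sub>m 1\<^sub>m ?n - 0\<^sub>m ?n ?n = ?c \<cdot>\<^sub>m 1\<^sub>m ?n"
    by (intro eq_matI) auto
  moreover have "edge_block G vs = 0\<^sub>m ?n ?n"
    by (intro eq_matI) (auto simp: edge_block_def edges)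
  ultimately have L: "integrated_laplacian G vs =
      four_block_mat (?c \<cdot>\<^sub>m 1\<^sub>m ?n) (- ?A) (- ?A) (?c \<cdot>\<^sub>m 1\<^sub>m ?n)"
    using \<open>m \<le> m * k\<close>
    by (subst integrated_laplacian_regular[where c = ?c])
      (simp_all add: arc_block_eq_parts_adjacency[OF arcs] of_nat_diff flip: of_nat_add)
  note affine = has_spectrum_affine[OF parts_adjacency_carrier
      has_spectrum_parts_adjacency[OF P vs k m], of ?c]
  have "?c \<cdot>\<^sub>m 1\<^sub>m ?n + - ?A = ?c \<cdot>\<^sub>m 1\<^sub>m ?n + (- 1) \<cdot>\<^sub>m ?A"
    "?c \<cdot>\<^sub>m 1\<^sub>m ?n - - ?A = ?c \<cdot>\<^sub>m 1\<^sub>m ?n + 1 \<cdot>\<^sub>m ?A"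
    by (auto intro!: eq_matI simp: parts_adjacency_def)
  then have "eigenvalue_mset (integrated_laplacian G vs) =
     {#?c + (- 1) * a. a \<in># add_mset (real m * real k - real m)
      (replicate_mset (k - 1) (- real m) + replicate_mset (m * k - k) 0)#} +
     {#?c + 1 * a. a \<in># add_mset (real m * real k - real m)
      (replicate_mset (k - 1) (- real m) + replicate_mset (m * k - k) 0)#}"
    unfolding L using affine[of "- 1"] affine[of 1]
    by (intro eigenvalue_mset_eqI has_spectrum_symmetric_block[where n = ?n]) simp_all
  moreover have "?c + (- 1) * (real m * real k - real m) = 0"
    "?c + (- 1) * (- real m) = real m * real k"
    "?c + (- 1) * 0 = real m * real k - real m"
    "?c + 1 * (real m * real k - real m) = 2 * real m * real k - 2 * real m"
    "?c + 1 * (- real m) = real m * real k - 2 * real m"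
    "?c + 1 * 0 = real m * real k - real m"
    by (simp_all add: algebra_simps)
  \<comment> \<open>The \<open>m k - k\<close> zero eigenvalues of \<open>A\<close> give the value
    \<open>c\<close> in both halves.\<close>
  moreover have "2 * k * m - 2 * k = (m * k - k) + (m * k - k)"
    using \<open>k \<le> m * k\<close> mult.commute[of m k] by linarith
  ultimately show ?thesis
    by (simp only: image_mset_add_mset image_mset_union image_replicate_mset replicate_mset_add
        replicate_mset_Suc One_nat_def replicate_mset_0) simp
qed

text \<open>Listed values may coincide: for \<open>k = 2\<close>, \<open>m k - 2 m = 0\<close> and
  \<open>m k = 2 m k - 2 m\<close>. The sums of multisets then add the multiplicities.\<close>

theorem theorem3p5:
  fixes k m :: nat
  assumes "k \<ge> 1" and "m \<ge> 1"
  shows "(\<forall>(G :: 'a mixed_graph) vs. is_KM k m G \<and> distinct vs \<and> set vs = verts G \<longrightarrow>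
            eigenvalue_mset (integrated_laplacian G vs) =
              replicate_mset 1 0
            + replicate_mset (k - 1) (2 * real m * real k)
            + replicate_mset (2 * m * k - k) (2 * real m * real k - 2 * real m))
       \<and> (\<forall>(G :: 'a mixed_graph) vs. is_KD k m G \<and> distinct vs \<and> set vs = verts G \<longrightarrow>
            eigenvalue_mset (integrated_laplacian G vs) =
              replicate_mset 1 (2 * real m * real k - 2 * real m)
            + replicate_mset 1 0
            + replicate_mset (k - 1) (real m * real k)
            + replicate_mset (k - 1) (real m * real k - 2 * real m)
            + replicate_mset (2 * k * m - 2 * k) (real m * real k - real m))"
  using eigenvalue_mset_KM[OF _ _ _ assms] eigenvalue_mset_KD[OF _ _ _ assms] by blast

end
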